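(* Let $d\ge 1$, $\mathsf{h}=\mathbb{C}^d$, let $L_1,\dots,L_m,H\in M_d(\mathbb{C})$ with $H$ self-adjoint, put $G=-\frac12\sum_{\ell=1}^m L_\ell^*L_\ell-\mathrm{i}H$, and let $\mathcal{T}=(\mathcal{T}_t)_{t\ge 0}$ be the quantum Markov semigroup on $M_d(\mathbb{C})$ with generator $$\mathcal{L}(x)=G^*x+\sum_{\ell=1}^m L_\ell^*xL_\ell+xG .$$ The following are equivalent: (1) the quantum Markov semigroup $\mathcal{T}$ is irreducible; (2) $\mathcal{S}(\xi)=\mathsf{h}$ for all non-zero $\xi\in\mathsf{h}$.
   Context: The quantum Markov semigroup generated by $\mathcal{L}$ is $\mathcal{T}_t=e^{t\mathcal{L}}$, $t\ge0$; it consists of completely positive, identity preserving maps on $M_d(\mathbb{C})$. Irreducibility: a projection $p\in M_d(\mathbb{C})$ (i.e. $p=p^*=p^2$) is subharmonic if $\mathcal{T}_t(p)\ge p$ for all $t\ge 0$. $\mathcal{T}$ is irreducible if there is no non-trivial subharmonic projection, non-trivial meaning different from $0$ and from the identity. The space $\mathcal{S}(\xi)$: for $A\in M_d(\mathbb{C})$ define recursively $\delta_G^0(A)=A$, $\delta_G^{n+1}(A)=[G,\delta_G^n(A)]$, where $[A,B]=AB-BA$. For non-zero $\xi\in\mathsf{h}$, $\mathcal{S}(\xi)$ is the (complex) linear span of $\xi$ and all the vectors $$\delta_G^{n_1}(L_{\ell_1})\delta_G^{n_2}(L_{\ell_2})\cdots\delta_G^{n_k}(L_{\ell_k})\xi,\qquad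 k\ge1,\ n_1,\dots,n_k\ge0,\ 1\le\ell_1,\dots,\ell_k\le m.$$ *)

theory Defs
  imports "HOL-Analysis.Analysis"
begin

text \<open>
  The space \<open>\<complex>\<^sup>d\<close> is \<^typ>\<open>complex ^ 'n\<close> with \<open>d = CARD('n) \<ge> 1\<close>. The inner product of
  \<^class>\<open>real_inner\<close> on this type is only the real part of the Hermitian one, and its \<^const>\<open>span\<close> is
  the real span; hence \<open>cinner\<close> below, and the use of \<^const>\<open>vec.span\<close>, the span over \<^typ>\<open>complex\<close>.
\<close>

definition cinner :: "complex ^ 'n \<Rightarrow> complex ^ 'n \<Rightarrow> complex" where
  "cinner u v = (\<Sum>i\<in>UNIV. cnj (u $ i) * v $ i)"

definition adj :: "complex ^ 'n ^ 'n \<Rightarrow> complex ^ 'n ^ 'n" where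
  "adj A = map_matrix cnj (transpose A)"

definition positive :: "complex ^ 'n ^ 'n \<Rightarrow> bool" where
  "positive A \<longleftrightarrow> (\<forall>v. cinner v (A *v v) \<in> \<real>\<^sub>\<ge>\<^sub>0)"

definition loewner_le :: "complex ^ 'n ^ 'n \<Rightarrow> complex ^ 'n ^ 'n \<Rightarrow> bool" where
  "loewner_le A B \<longleftrightarrow> positive (B - A)"

definition projection :: "complex ^ 'n ^ 'n \<Rightarrow> bool" where
  "projection p \<longleftrightarrow> adj p = p \<and> p ** p = p"

definition commutator :: "complex ^ 'n ^ 'n \<Rightarrow> complex ^ 'n ^ 'n \<Rightarrow> complex ^ 'n ^ 'n" where
  "commutator A B = A ** B - B ** A"

primrec delta :: "complex ^ 'n ^ 'n \<Rightarrow> nat \<Rightarrow> complex ^ 'n ^ 'n \<Rightarrow> complex ^ 'n ^ 'n" where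
  "delta G 0 A = A"
| "delta G (Suc n) A = commutator G (delta G n A)"

definition G_op ::
  "nat \<Rightarrow> (nat \<Rightarrow> complex ^ 'n ^ 'n) \<Rightarrow> complex ^ 'n ^ 'n \<Rightarrow> complex ^ 'n ^ 'n" where
  "G_op m L H = - ((1 / 2) *\<^sub>R (\<Sum>l=1..m. adj (L l) ** L l)) - map_matrix (\<lambda>z. \<i> * z) H"

definition generator ::
  "nat \<Rightarrow> (nat \<Rightarrow> complex ^ 'n ^ 'n) \<Rightarrow> complex ^ 'n ^ 'n \<Rightarrow> complex ^ 'n ^ 'n \<Rightarrow> complex ^ 'n ^ 'n" where
  "generator m L H x =
     adj (G_op m L H) ** x + (\<Sum>l=1..m. adj (L l) ** x ** L l) + x ** G_op m L H"

text \<open>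
  The library has no exponential of a linear map, so \<open>e\<^bsup>t\<Phi>\<^esup>\<close> is defined by its power series, evaluated
  pointwise. For a linear map in finite dimension the series converges at every point.
\<close>

definition exp_semigroup :: "('a::real_normed_vector \<Rightarrow> 'a) \<Rightarrow> real \<Rightarrow> 'a \<Rightarrow> 'a" where
  "exp_semigroup \<Phi> t x = (\<Sum>k. (t ^ k / fact k) *\<^sub>R (\<Phi> ^^ k) x)"

lemma summable_exp_semigroup:
  fixes \<Phi> :: "'a::euclidean_space \<Rightarrow> 'a"
  assumes "linear \<Phi>"
  shows "summable (\<lambda>k. (t ^ k / fact k) *\<^sub>R (\<Phi> ^^ k) x)"
proof -
  obtain K where K: "\<And>y. norm (\<Phi> y) \<le> K * norm y" and "K > 0"
    using linear_bounded_pos[OF assms] by blast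
  have bound: "norm ((\<Phi> ^^ k) x) \<le> K ^ k * norm x" for k
  proof (induction k)
    case (Suc k)
    have "norm ((\<Phi> ^^ Suc k) x) \<le> K * norm ((\<Phi> ^^ k) x)" using K by simp
    also have "\<dots> \<le> K * (K ^ k * norm x)" using Suc \<open>K > 0\<close> by simp
    finally show ?case by (simp add: mult.assoc)
  qed simp
  have "norm ((t ^ k / fact k) *\<^sub>R (\<Phi> ^^ k) x) \<le> inverse (fact k) * (\<bar>t\<bar> * K) ^ k * norm x" for k
  proof -
    have "norm ((t ^ k / fact k) *\<^sub>R (\<Phi> ^^ k) x) = \<bar>t\<bar> ^ k / fact k * norm ((\<Phi> ^^ k) x)"
      by (simp add: power_abs)
    also have "\<dots> \<le> \<bar>t\<bar> ^ k / fact k * (K ^ k * norm x)"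
      using bound by (intro mult_left_mono) auto
    finally show ?thesis by (simp add: power_mult_distrib field_simps)
  qed
  moreover have "summable (\<lambda>k. inverse (fact k) * (\<bar>t\<bar> * K) ^ k * norm x)"
    by (intro summable_mult2 summable_exp)
  ultimately show ?thesis by (rule summable_comparison_test'[rotated])
qed

definition qms ::
  "nat \<Rightarrow> (nat \<Rightarrow> complex ^ 'n ^ 'n) \<Rightarrow> complex ^ 'n ^ 'n \<Rightarrow> real \<Rightarrow> complex ^ 'n ^ 'n \<Rightarrow> complex ^ 'n ^ 'n" where
  "qms m L H = exp_semigroup (generator m L H)"

lemma linear_generator: "linear (generator m L H)"
proof (rule linearI)
  have add: "A ** (x + y) = A ** x + A ** y" "(x + y) ** A = x ** A + y ** A"
    and scale: "A ** (c *\<^sub>R x) = c *\<^sub>R (A ** x)" "(c *\<^sub>R x) ** A = c *\<^sub>R (x ** A)"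
    for A x y :: "complex ^ 'n ^ 'n" and c
    by (simp_all add: matrix_matrix_mult_def vec_eq_iff scaleR_sum_right algebra_simps sum.distrib)
  show "generator m L H (x + y) = generator m L H x + generator m L H y" for x y
    by (simp add: generator_def add sum.distrib)
  show "generator m L H (c *\<^sub>R x) = c *\<^sub>R generator m L H x" for c x
    by (simp add: generator_def scale scaleR_add_right scaleR_sum_right)
qed

definition subharmonic ::
  "(real \<Rightarrow> complex ^ 'n ^ 'n \<Rightarrow> complex ^ 'n ^ 'n) \<Rightarrow> complex ^ 'n ^ 'n \<Rightarrow> bool" where
  "subharmonic T p \<longleftrightarrow> projection p \<and> (\<forall>t\<ge>0. loewner_le p (T t p))"

definition irreducible_qms ::
  "(real \<Rightarrow> complex ^ 'n ^ 'n \<Rightarrow> complex ^ 'n ^ 'n) \<Rightarrow> bool" where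
  "irreducible_qms T \<longleftrightarrow> \<not> (\<exists>p. subharmonic T p \<and> p \<noteq> 0 \<and> p \<noteq> mat 1)"

text \<open>
  A word \<open>[(n\<^sub>1, l\<^sub>1), \<dots>, (n\<^sub>k, l\<^sub>k)]\<close> stands for the product
  \<open>\<delta>\<^sub>G\<^bsup>n\<^sub>1\<^esup>(L\<^bsub>l\<^sub>1\<^esub>) \<cdots> \<delta>\<^sub>G\<^bsup>n\<^sub>k\<^esup>(L\<^bsub>l\<^sub>k\<^esub>)\<close>.
\<close>

definition delta_word ::
  "complex ^ 'n ^ 'n \<Rightarrow> (nat \<Rightarrow> complex ^ 'n ^ 'n) \<Rightarrow> (nat \<times> nat) list \<Rightarrow> complex ^ 'n ^ 'n" where
  "delta_word G L w = foldr (\<lambda>(n, l) M. delta G n (L l) ** M) w (mat 1)"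

definition S_space ::
  "nat \<Rightarrow> (nat \<Rightarrow> complex ^ 'n ^ 'n) \<Rightarrow> complex ^ 'n ^ 'n \<Rightarrow> complex ^ 'n \<Rightarrow> (complex ^ 'n) set" where
  "S_space m L H \<xi> = vec.span (insert \<xi>
     {delta_word (G_op m L H) L w *v \<xi> | w. w \<noteq> [] \<and> (\<forall>(n, l)\<in>set w. l \<in> {1..m})})"

end

theory Submission
  imports Defs "HOL-Computational_Algebra.Fundamental_Theorem_Algebra"
begin

text \<open>
  Minimum principle: a projection is subharmonic iff \<open>\<L>(p) \<ge> 0\<close>, and this holds iff the range of \<open>p\<close> is
  invariant under \<open>G\<close> and all \<open>L\<^sub>l\<close>. So irreducibility says that \<open>G\<close> and the \<open>L\<^sub>l\<close> have no common proper
  invariant subspace, while (2) says this for the set \<open>D\<close> of all \<open>\<delta>\<^sub>G\<^sup>n(L\<^sub>l)\<close> without \<open>G\<close>. The point is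
  that \<open>G\<close> can be dropped because \<open>[G, D] \<subseteq> D\<close>.

  The commutant \<open>C\<close> of \<open>D\<close> is stable under \<open>[G, \<cdot>]\<close>. If \<open>X \<in> C\<close> is traceless with \<open>[G, X] = c X\<close>, then
  \<open>ker X\<close> is invariant under \<open>G\<close> and \<open>D\<close>; if it is zero, taking the trace of \<open>G - X G X\<^sup>-\<^sup>1 = c\<close> gives
  \<open>c = 0\<close>, and an eigenspace of \<open>X\<close> is invariant. Hence \<open>C\<close> is trivial. If on the other hand \<open>D\<close> has a proper
  invariant subspace, let \<open>V\<close> be a minimal nonzero one and \<open>F\<^sub>k = V + G V + \<dots> + G\<^sup>k\<^sup>-\<^sup>1 V\<close>. For the \<open>K\<close> with
  \<open>F\<^sub>K \<noteq> \<complex>\<^sup>d = F\<^sub>K\<^sub>+\<^sub>1\<close>, the map \<open>G\<^sup>K\<close> induces an isomorphism \<open>V \<cong> \<complex>\<^sup>d / F\<^sub>K\<close> of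
  \<open>D\<close>-modules, whose inverse yields a nonscalar element \<open>\<complex>\<^sup>d \<rightarrow> \<complex>\<^sup>d / F\<^sub>K \<rightarrow> V\<close> of \<open>C\<close>.
\<close>

subsection \<open>Eigenvectors of complex-linear maps on matrices\<close>

lemma matrix_diff_ldistrib: "A ** (B - C) = A ** B - A ** (C :: 'a::ring_1 ^ _ ^ _)"
  by (simp add: matrix_matrix_mult_def vec_eq_iff algebra_simps sum_subtractf)

lemma matrix_diff_rdistrib: "(B - C) ** A = B ** A - (C :: 'a::ring_1 ^ _ ^ _) ** A"
  by (simp add: matrix_matrix_mult_def vec_eq_iff algebra_simps sum_subtractf)

lemma matrix_add_rdistrib: "(B + C) ** A = B ** A + (C :: 'a::semiring_1 ^ _ ^ _) ** A"
  by (simp add: matrix_matrix_mult_def vec_eq_iff algebra_simps sum.distrib)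

lemma mat_mult_left: "mat c ** A = (\<chi> i j. c * A $ i $ j)" for A :: "'a::semiring_1 ^ 'm ^ 'n"
  by (simp add: matrix_matrix_mult_def mat_def vec_eq_iff if_distrib [where f = "\<lambda>x. x * _"] cong: if_cong)

lemma mat_mult_commute: "A ** mat c = mat c ** A" for A :: "'a::comm_semiring_1 ^ 'n ^ 'n"
  unfolding mat_mult_left
  by (simp add: matrix_matrix_mult_def mat_def vec_eq_iff if_distrib mult.commute cong: if_cong)

lemma mat_mult_vec: "mat c *v x = c *s x" for x :: "'a::semiring_1 ^ 'n"
  by (simp add: matrix_vector_mult_def mat_def vec_eq_iff if_distrib [where f = "\<lambda>x. x * _"] cong: if_cong)

text \<open>This is p(T)x. Complex scalars act on matrices as \<open>mat c\<close>, since
  \<open>*\<^sub>R\<close> takes only real ones.\<close>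

definition poly_apply ::
  "(complex ^ 'n ^ 'n \<Rightarrow> complex ^ 'n ^ 'n) \<Rightarrow> complex poly \<Rightarrow> complex ^ 'n ^ 'n \<Rightarrow> complex ^ 'n ^ 'n" where
  "poly_apply T p x = (\<Sum>i\<le>degree p. mat (coeff p i) ** (T ^^ i) x)"

lemma poly_apply_bound:
  assumes "degree p \<le> n"
  shows "poly_apply T p x = (\<Sum>i\<le>n. mat (coeff p i) ** (T ^^ i) x)"
  unfolding poly_apply_def
  by (rule sum.mono_neutral_left) (use assms in \<open>auto simp: coeff_eq_0\<close>)

text \<open>Multiplication by the variable shifts coefficients and so applies T once more. If the
  product annihilates x, then q(T)x is an eigenvector for c or zero.\<close>

lemma poly_apply_linear_factor:
  assumes T: "\<And>x y. T (x + y) = T x + T y" "\<And>c x. T (mat c ** x) = mat c ** T x"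
  shows "poly_apply T ([:-c, 1:] * q) x = T (poly_apply T q x) - mat c ** poly_apply T q x"
proof -
  interpret additive T by standard (rule T)
  have "poly_apply T ([:-c, 1:] * q) x = (\<Sum>i\<le>Suc (degree q). mat (coeff ([:-c, 1:] * q) i) ** (T ^^ i) x)"
    using degree_mult_le[of "[:-c, 1:]" q] by (intro poly_apply_bound) (simp del: mult_pCons_left)
  also have "\<dots> = (\<Sum>i\<le>Suc (degree q). mat (coeff (pCons 0 q) i) ** (T ^^ i) x) -
      (\<Sum>i\<le>Suc (degree q). mat (c * coeff q i) ** (T ^^ i) x)"
    unfolding sum_subtractf[symmetric]
    by (rule sum.cong) (simp_all add: mat_mult_left vec_eq_iff algebra_simps)
  also have "(\<Sum>i\<le>Suc (degree q). mat (coeff (pCons 0 q) i) ** (T ^^ i) x) = T (poly_apply T q x)"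
    unfolding poly_apply_def sum T(2)
    by (simp add: sum.atMost_Suc_shift mat_mult_left zero_vec_def del: sum.atMost_Suc)
  also have "(\<Sum>i\<le>Suc (degree q). mat (c * coeff q i) ** (T ^^ i) x) = mat c ** poly_apply T q x"
    unfolding poly_apply_bound[OF le_SucI[OF order.refl]]
    by (simp add: mat_mult_left vec_eq_iff sum_distrib_left algebra_simps del: sum.atMost_Suc)
  finally show ?thesis .
qed

lemma iterates_dependent:
  fixes T :: "'a::euclidean_space \<Rightarrow> 'a"
  obtains c n where "c n \<noteq> (0::real)" "(\<Sum>i\<le>n. c i *\<^sub>R (T ^^ i) x) = 0"
proof -
  let ?f = "\<lambda>i. (T ^^ i) x"
  let ?N = "{..DIM('a)}"
  have "\<exists>c. (\<exists>i\<in>?N. c i \<noteq> 0) \<and> (\<Sum>i\<in>?N. c i *\<^sub>R ?f i) = 0"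
  proof (cases "inj_on ?f ?N")
    case True
    then have "dependent (?f ` ?N)"
      by (intro dependent_biggerset) (simp_all add: card_image)
    then obtain u where "\<exists>v\<in>?f ` ?N. u v \<noteq> 0" "(\<Sum>v\<in>?f ` ?N. u v *\<^sub>R v) = 0"
      by (auto simp: dependent_finite)
    with True show ?thesis
      by (intro exI[of _ "u \<circ> ?f"]) (auto simp: sum.reindex)
  next
    case False
    then obtain i j where ij: "i \<in> ?N" "j \<in> ?N" "i \<noteq> j" "?f i = ?f j"
      by (auto simp: inj_on_def)
    \<comment> \<open>\<open>dependent\<close> concerns the set of iterates and cannot see a
      repetition; two equal iterates give a relation with coefficients 1 and -1.\<close>
    let ?c = "\<lambda>k. if k = i then 1 else if k = j then -1 else 0 :: real"
    have "(\<Sum>k\<in>?N. ?c k *\<^sub>R ?f k) = (\<Sum>k\<in>{i, j}. ?c k *\<^sub>R ?f k)"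
      by (rule sum.mono_neutral_right) (use ij in auto)
    also have "\<dots> = 0" using ij by simp
    finally show ?thesis using ij by (intro exI[of _ ?c]) auto
  qed
  then obtain c where c: "\<exists>i\<in>?N. c i \<noteq> 0" "(\<Sum>i\<in>?N. c i *\<^sub>R ?f i) = 0" by blast
  \<comment> \<open>Cutting at the last nonzero coefficient gives a relation whose leading
    coefficient is nonzero.\<close>
  define n where "n = Max {i \<in> ?N. c i \<noteq> 0}"
  have n: "n \<in> {i \<in> ?N. c i \<noteq> 0}" unfolding n_def by (rule Max_in) (use c in auto)
  have "(\<Sum>i\<in>?N. c i *\<^sub>R ?f i) = (\<Sum>i\<le>n. c i *\<^sub>R ?f i)"
  proof (rule sum.mono_neutral_right)
    have "c i = 0" if "i \<in> ?N - {..n}" for i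
    proof (rule ccontr)
      assume "c i \<noteq> 0"
      then have "i \<le> n" unfolding n_def using that by (intro Max_ge) auto
      with that show False by simp
    qed
    then show "\<forall>i\<in>?N - {..n}. c i *\<^sub>R ?f i = 0" by simp
  qed (use n in auto)
  with c n show thesis by (intro that[of c n]) auto
qed

text \<open>A nonzero polynomial annihilating x under T is stripped of its roots one at a time; the
  first nonzero q(T)x met on the way is an eigenvector. It lies in W because W is stable under T and
  complex combinations.\<close>

lemma eigenmatrix_exists:
  fixes T :: "complex ^ 'n ^ 'n \<Rightarrow> complex ^ 'n ^ 'n"
  assumes add: "\<And>x y. T (x + y) = T x + T y" and scale: "\<And>c x. T (mat c ** x) = mat c ** T x"
    and W_add: "\<And>x y. x \<in> W \<Longrightarrow> y \<in> W \<Longrightarrow> x + y \<in> W"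
    and W_scale: "\<And>c x. x \<in> W \<Longrightarrow> mat c ** x \<in> W"
    and W_T: "\<And>x. x \<in> W \<Longrightarrow> T x \<in> W"
    and x: "x \<in> W" "x \<noteq> 0"
  obtains y c where "y \<in> W" "y \<noteq> 0" "T y = mat c ** y"
proof -
  have ex: "\<exists>y\<in>W. y \<noteq> 0 \<and> (\<exists>c. T y = mat c ** y)" if "poly_apply T p x = 0" "p \<noteq> 0" for p
    using that
  proof (induction "degree p" arbitrary: p)
    case 0
    then obtain a where "p = [:a:]" "a \<noteq> 0" by (metis degree_0_id degree_eq_zeroE pCons_0_0)
    with 0 x show ?case
      by (auto simp: poly_apply_def mat_mult_left vec_eq_iff)
  next
    case (Suc k)
    then obtain c where "poly p c = 0"
      using fundamental_theorem_of_algebra[of p] constant_degree[of p] by auto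
    then obtain q where q: "p = [:-c, 1:] * q" by (metis poly_eq_0_iff_dvd dvdE)
    with Suc have "q \<noteq> 0" by auto
    then have deg: "k = degree q" using Suc q by (simp add: degree_mult_eq del: mult_pCons_left)
    have in_W: "poly_apply T q x \<in> W"
    proof -
      have Ti: "(T ^^ i) x \<in> W" for i by (induction i) (use x W_T in auto)
      have "(\<Sum>i\<le>n. mat (a i) ** (T ^^ i) x) \<in> W" for a :: "nat \<Rightarrow> complex" and n
        by (induction n) (use Ti Ti[of "Suc _"] W_add W_scale x in auto)
      then show ?thesis by (simp add: poly_apply_def)
    qed
    show ?case
    proof (cases "poly_apply T q x = 0")
      case True
      then show ?thesis using Suc deg \<open>q \<noteq> 0\<close> by blast
    next
      case False
      have "T (poly_apply T q x) - mat c ** poly_apply T q x = 0"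
        using poly_apply_linear_factor[of T c q x] add scale Suc q by simp
      then show ?thesis using in_W False by (intro bexI[of _ "poly_apply T q x"]) auto
    qed
  qed
  obtain c n where c: "c n \<noteq> (0::real)" "(\<Sum>i\<le>n. c i *\<^sub>R (T ^^ i) x) = 0"
    by (rule iterates_dependent)
  define p where "p = (\<Sum>i\<le>n. monom (complex_of_real (c i)) i)"
  have coeff_p: "coeff p i = (if i \<le> n then of_real (c i) else 0)" for i
    by (simp add: p_def coeff_sum)
  have "p \<noteq> 0" using c coeff_p[of n] by auto
  moreover have "degree p \<le> n" by (rule degree_le) (simp add: coeff_p)
  then have "poly_apply T p x = (\<Sum>i\<le>n. c i *\<^sub>R (T ^^ i) x)"
    unfolding poly_apply_bound[OF \<open>degree p \<le> n\<close>]
    by (intro sum.cong) (auto simp: coeff_p mat_mult_left vec_eq_iff scaleR_conv_of_real[where 'a = complex])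
  ultimately show thesis using c ex that by metis
qed

subsection \<open>Invariant subspaces and the commutant\<close>

definition invariant_subspace :: "(complex ^ 'n ^ 'n) set \<Rightarrow> (complex ^ 'n) set \<Rightarrow> bool" where
  "invariant_subspace D W \<longleftrightarrow> vec.subspace W \<and> (\<forall>A\<in>D. \<forall>w\<in>W. A *v w \<in> W)"

definition irreducible_set :: "(complex ^ 'n ^ 'n) set \<Rightarrow> bool" where
  "irreducible_set D \<longleftrightarrow> (\<forall>W. invariant_subspace D W \<longrightarrow> W = {0} \<or> W = UNIV)"

text \<open>If Xv = 0 then XGv = GXv - cXv = 0, so ker X is invariant under G as well as under D.
  Being proper it is zero, and an injective square matrix is invertible.\<close>

lemma kernel_trivial:
  assumes irr: "irreducible_set (insert G D)"
    and D: "\<And>A. A \<in> D \<Longrightarrow> X ** A = A ** X"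
    and G: "G ** X - X ** G = mat c ** X"
    and "X \<noteq> 0"
  obtains B where "B ** X = mat 1" "X ** B = mat 1"
proof -
  have "invariant_subspace (insert G D) {v. X *v v = 0}"
    unfolding invariant_subspace_def
  proof (intro conjI ballI)
    show "vec.subspace {v. X *v v = 0}" by (rule vec.subspace_kernel)
    fix A w assume "A \<in> insert G D" "w \<in> {v. X *v v = 0}"
    then have w: "X *v w = 0" and A: "A = G \<or> A \<in> D" by auto
    have "X *v (A *v w) = 0"
    proof (cases "A \<in> D")
      case True
      then show ?thesis using D[of A] w by (simp add: matrix_vector_mul_assoc) (simp flip: matrix_vector_mul_assoc)
    next
      case False
      have "X ** G = G ** X - mat c ** X" using G by (simp add: algebra_simps)
      with False A w show ?thesis
        by (simp add: matrix_vector_mul_assoc matrix_vector_mult_diff_rdistrib)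
          (simp flip: matrix_vector_mul_assoc)
    qed
    then show "A *v w \<in> {v. X *v v = 0}" by simp
  qed
  then have "{v. X *v v = 0} = {0} \<or> {v. X *v v = 0} = UNIV"
    using irr by (auto simp: irreducible_set_def)
  moreover have "{v. X *v v = 0} \<noteq> UNIV"
    using \<open>X \<noteq> 0\<close> by (auto simp: matrix_eq)
  ultimately have "\<forall>v. X *v v = 0 \<longrightarrow> v = 0" by auto
  then obtain B where "B ** X = mat 1" by (auto simp: matrix_left_invertible_ker[symmetric])
  with that show thesis by (simp add: matrix_left_right_inverse)
qed

lemma trace_mat: "trace (mat c :: 'a::comm_semiring_1 ^ 'n ^ 'n) = of_nat CARD('n) * c"
  by (simp add: trace_def mat_def)

lemma trace_mat_mult: "trace (mat c ** A) = c * trace A" for A :: "'a::comm_semiring_1 ^ 'n ^ 'n"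
  by (simp add: trace_def mat_mult_left sum_distrib_left)

lemma commutant_trivial:
  fixes G :: "complex ^ 'n ^ 'n"
  assumes irr: "irreducible_set (insert G D)"
    and closed: "\<And>A. A \<in> D \<Longrightarrow> commutator G A \<in> D"
    and X: "\<And>A. A \<in> D \<Longrightarrow> X ** A = A ** X"
  obtains c where "X = mat c"
proof (rule ccontr)
  assume "\<not> thesis"
  define W where "W = {Y. (\<forall>A\<in>D. Y ** A = A ** Y) \<and> trace Y = 0}"
  \<comment> \<open>Removing the scalar part makes the trace vanish; X0 is nonzero because X is not
    scalar.\<close>
  define X0 where "X0 = X - mat (trace X / of_nat CARD('n))"
  have "X0 \<in> W" "X0 \<noteq> 0"
    using X \<open>\<not> thesis\<close> that
    by (auto simp: W_def X0_def matrix_diff_ldistrib matrix_diff_rdistrib mat_mult_commute trace_sub trace_mat)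
  have *: "commutator G Y \<in> W" if "Y \<in> W" for Y
  proof -
    have Y: "Y ** A = A ** Y" if "A \<in> D" for A using \<open>Y \<in> W\<close> that by (auto simp: W_def)
    \<comment> \<open>Jacobi identity: [[G, Y], A] = [G, [Y, A]] - [Y, [G, A]], and both terms
      vanish because [G, A] lies in D.\<close>
    have "commutator G Y ** A = A ** commutator G Y" if "A \<in> D" for A
    proof -
      have "G ** (A ** Y) = G ** (Y ** A)" "Y ** (A ** G) = A ** (Y ** G)"
        using Y[OF that] by (simp_all add: matrix_mul_assoc)
      then show ?thesis
        using Y[OF closed[OF that]]
        by (simp add: commutator_def matrix_diff_ldistrib matrix_diff_rdistrib matrix_mul_assoc[symmetric] algebra_simps)
    qed
    then show ?thesis by (auto simp: W_def commutator_def trace_sub trace_mul_sym[of G Y])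
  qed
  have linear: "commutator G (Y + Z) = commutator G Y + commutator G Z"
    "commutator G (mat c ** Y) = mat c ** commutator G Y" for c Y Z
    by (simp_all add: commutator_def matrix_add_ldistrib matrix_add_rdistrib matrix_diff_ldistrib mat_mult_commute
        matrix_mul_assoc)
  have W_add: "Y + Z \<in> W" if "Y \<in> W" "Z \<in> W" for Y Z
    using that by (auto simp: W_def matrix_add_ldistrib matrix_add_rdistrib trace_add)
  have W_scale: "mat c ** Y \<in> W" if "Y \<in> W" for c Y
  proof -
    have "mat c ** Y ** A = A ** (mat c ** Y)" if "A \<in> D" for A
    proof -
      have "mat c ** Y ** A = mat c ** A ** Y"
        using \<open>Y \<in> W\<close> that by (simp add: W_def flip: matrix_mul_assoc)
      then show ?thesis by (simp add: matrix_mul_assoc mat_mult_commute[of A])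
    qed
    with that show ?thesis by (simp add: W_def trace_mat_mult)
  qed
  obtain Y c where Y: "Y \<in> W" "Y \<noteq> 0" "commutator G Y = mat c ** Y"
    by (rule eigenmatrix_exists[OF linear W_add W_scale * \<open>X0 \<in> W\<close> \<open>X0 \<noteq> 0\<close>])
  have YD: "\<And>A. A \<in> D \<Longrightarrow> Y ** A = A ** Y" and "trace Y = 0" using Y by (auto simp: W_def)
  have GY: "G ** Y - Y ** G = mat c ** Y" using Y by (simp add: commutator_def)
  obtain B where B: "B ** Y = mat 1" "Y ** B = mat 1"
    using kernel_trivial[OF irr YD GY] Y by blast
  \<comment> \<open>Multiplying by the inverse of Y writes the scalar c as G minus a conjugate of G,
    which has the same trace; hence c = 0.\<close>
  have "(G ** Y - Y ** G) ** B = mat c"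
    using B by (simp add: GY flip: matrix_mul_assoc)
  then have "G - Y ** G ** B = mat c"
    using B by (simp add: matrix_diff_rdistrib flip: matrix_mul_assoc)
  moreover have "trace (Y ** G ** B) = trace G"
    using B trace_mul_sym[of "Y ** G" B] by (simp add: matrix_mul_assoc)
  ultimately have "trace (mat c :: complex ^ 'n ^ 'n) = 0" by (metis trace_sub diff_self)
  then have "c = 0" by (simp add: trace_mat)
  then have YG: "Y ** G = G ** Y"
    using GY by (simp add: mat_mult_left vec_eq_iff)
  have one: "mat 1 \<noteq> (0 :: complex ^ 'n ^ 'n)" by (simp add: mat_def vec_eq_iff)
  have Y_scale: "Y ** (mat c ** Z) = mat c ** (Y ** Z)" for c Z
    by (simp add: matrix_mul_assoc mat_mult_commute[of Y])
  \<comment> \<open>Left multiplication by Y acts column by column, so a nonzero column of Z is an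
    eigenvector of Y.\<close>
  obtain Z :: "complex ^ 'n ^ 'n" and a where Z: "Z \<in> UNIV" "Z \<noteq> 0" "Y ** Z = mat a ** Z"
    by (rule eigenmatrix_exists[of "(**) Y" UNIV, OF matrix_add_ldistrib Y_scale UNIV_I UNIV_I UNIV_I UNIV_I one])
  \<comment> \<open>Otherwise \<open>kernel_trivial\<close> with c = 0 would make Y - a invertible,
    although it annihilates Z.\<close>
  have "Y - mat a = 0"
  proof (rule ccontr)
    assume "Y - mat a \<noteq> 0"
    moreover have "(Y - mat a) ** A = A ** (Y - mat a)" if "A \<in> D" for A
      using YD[OF that] by (simp add: matrix_diff_ldistrib matrix_diff_rdistrib mat_mult_commute)
    moreover have "G ** (Y - mat a) - (Y - mat a) ** G = mat 0 ** (Y - mat a)"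
      using YG by (simp add: matrix_diff_ldistrib matrix_diff_rdistrib mat_mult_commute)
    ultimately obtain B where "B ** (Y - mat a) = mat 1"
      using kernel_trivial[OF irr] by blast
    moreover have "(Y - mat a) ** Z = 0" using Z by (simp add: matrix_diff_rdistrib)
    ultimately have "Z = B ** 0" by (metis matrix_mul_assoc matrix_mul_lid)
    with Z show False by (simp add: matrix_matrix_mult_def vec_eq_iff)
  qed
  then have "Y = mat a" by simp
  with \<open>trace Y = 0\<close> have "a = 0" by (simp add: trace_mat)
  with \<open>Y = mat a\<close> Y show False by (simp add: mat_def vec_eq_iff)
qed

section \<open>Dropping G: the filtration generated by a minimal submodule\<close>

lemma mat_pow_vec: "((**) G ^^ Suc k) (mat 1) *v v = G *v (((**) G ^^ k) (mat 1) *v v)"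
  for G :: "complex ^ 'n ^ 'n"
  by (simp add: matrix_vector_mul_assoc)

lemma commutator_vec: "commutator A B *v v = A *v (B *v v) - B *v (A *v v)"
  by (simp add: commutator_def matrix_vector_mult_diff_rdistrib matrix_vector_mul_assoc)

text \<open>Closure of D under [G, .] does two things: it keeps every \<open>F k\<close> invariant
  under D, and it makes the k-th power of G commute with D on V modulo \<open>F k\<close>.\<close>

lemma irreducible_set_commutator_closed:
  fixes G :: "complex ^ 'n ^ 'n"
  assumes irr: "irreducible_set (insert G D)"
    and closed: "\<And>A. A \<in> D \<Longrightarrow> commutator G A \<in> D"
  shows "irreducible_set D"
proof (rule ccontr)
  assume "\<not> irreducible_set D"
  then obtain S where S: "invariant_subspace D S" "S \<noteq> {0}" "S \<noteq> UNIV"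
    by (auto simp: irreducible_set_def)
  obtain V where V: "invariant_subspace D V" "V \<noteq> {0}"
    and min: "\<And>U. invariant_subspace D U \<Longrightarrow> U \<noteq> {0} \<Longrightarrow> vec.dim V \<le> vec.dim U"
    using ex_has_least_nat[of "\<lambda>U. invariant_subspace D U \<and> U \<noteq> {0}" S vec.dim] S by blast
  have V_sub: "vec.subspace V" and V_inv: "\<And>A v. A \<in> D \<Longrightarrow> v \<in> V \<Longrightarrow> A *v v \<in> V"
    using V by (auto simp: invariant_subspace_def)
  \<comment> \<open>Least dimension makes V a simple D-module.\<close>
  have min_eq: "U = V" if "invariant_subspace D U" "U \<noteq> {0}" "U \<subseteq> V" for U
    using vec.subspace_dim_equal[of U V] min[OF that(1,2)] that V_sub
    by (auto simp: invariant_subspace_def)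
  have "V \<noteq> UNIV"
  proof
    assume "V = UNIV"
    then have "vec.dim S = vec.dim (UNIV :: (complex ^ 'n) set)"
      using min[OF S(1,2)] vec.dim_subset[of S UNIV] by auto
    then show False
      using vec.subspace_dim_equal[of S UNIV] S by (auto simp: invariant_subspace_def)
  qed
  \<comment> \<open>The index counts summands: \<open>F k\<close> is V + G V + ... up to the power k
    - 1 of G, so \<open>F 1\<close> is V.\<close>
  define F where "F = rec_nat {0} (\<lambda>_ U. {v + G *v w | v w. v \<in> V \<and> w \<in> U})"
  have F_0: "F 0 = {0}" and F_Suc: "F (Suc k) = {v + G *v w | v w. v \<in> V \<and> w \<in> F k}" for k
    by (simp_all add: F_def)
  have F_sub: "vec.subspace (F k)" for k
  proof (induction k)
    case (Suc k)
    have "F (Suc k) = {x + y | x y. x \<in> V \<and> y \<in> (*v) G ` F k}" by (auto simp: F_Suc)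
    then show ?case using vec.subspace_sums[OF V_sub vec.subspace_image[OF Suc]] by simp
  qed (simp add: F_0)
  have zero: "0 \<in> V" "0 \<in> F k" for k
    using V_sub F_sub by (simp_all add: vec.subspace_0)
  have F_mono: "F k \<subseteq> F (Suc k)" for k
  proof (induction k)
    case 0
    show ?case using zero(2)[of "Suc 0"] by (simp add: F_0)
  next
    case (Suc k)
    then show ?case unfolding F_Suc[of "Suc k"] by (subst F_Suc) blast
  qed
  have V_F: "V \<subseteq> F (Suc k)" for k
    using zero(2)[of k] by (auto simp: F_Suc) (metis add.right_neutral matrix_vector_mult_0_right)
  have G_F: "G *v w \<in> F (Suc k)" if "w \<in> F k" for w k
    using zero(1) that by (auto simp: F_Suc) (metis add.left_neutral)
  have F_inv: "A *v w \<in> F k" if "A \<in> D" "w \<in> F k" for A w k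
    using that
  proof (induction k arbitrary: A w)
    case 0
    then show ?case by (simp add: F_0)
  next
    case (Suc k)
    then obtain v u where w: "w = v + G *v u" "v \<in> V" "u \<in> F k" by (auto simp: F_Suc)
    \<comment> \<open>Moving A past G costs a commutator, which lies in D again and keeps u inside
      \<open>F k\<close>.\<close>
    have "A *v w = A *v v + G *v (A *v u) - commutator G A *v u"
      by (simp add: w commutator_vec algebra_simps)
    moreover have "A *v v \<in> F (Suc k)" using V_inv V_F w Suc by blast
    moreover have "G *v (A *v u) \<in> F (Suc k)" using Suc w G_F by blast
    moreover have "commutator G A *v u \<in> F (Suc k)" using Suc w closed F_mono by blast
    ultimately show ?case using F_sub by (metis vec.subspace_add vec.subspace_diff)
  qed
  \<comment> \<open>Where the chain stops growing, \<open>F k\<close> is invariant under G too. It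
    contains V then, so it must be the whole space.\<close>
  have step: "F k \<noteq> F (Suc k)" if "F k \<noteq> UNIV" for k
  proof
    assume eq: "F k = F (Suc k)"
    then have "invariant_subspace (insert G D) (F k)"
      using F_sub F_inv G_F by (auto simp: invariant_subspace_def)
    then have "F k = {0}" using irr that by (auto simp: irreducible_set_def)
    then have "V \<subseteq> {0}" using eq V_F[of k] by metis
    with \<open>V \<noteq> {0}\<close> zero(1) show False by auto
  qed
  have "\<exists>k. F k = UNIV"
  proof (rule ccontr)
    assume "\<nexists>k. F k = UNIV"
    then have less: "vec.dim (F k) < vec.dim (F (Suc k))" for k
      using step[of k] F_mono[of k] F_sub vec.subspace_dim_equal[of "F k" "F (Suc k)"] by fastforce
    have "k \<le> vec.dim (F k)" for k
      by (induction k) (use less in \<open>auto simp: Suc_le_eq intro: le_less_trans\<close>)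
    then have "Suc CARD('n) \<le> vec.dim (F (Suc CARD('n)))" by blast
    then show False using vec.dim_subset[of "F (Suc CARD('n))" UNIV] unfolding vec_dim_card by simp
  qed
  define N where "N = (LEAST k. F k = UNIV)"
  have "F N = UNIV" unfolding N_def using \<open>\<exists>k. F k = UNIV\<close> by (rule LeastI_ex)
  have "N \<noteq> 0" using \<open>F N = UNIV\<close> \<open>V \<noteq> UNIV\<close> \<open>V \<noteq> {0}\<close> by (intro notI) (auto simp: F_0)
  then obtain K where K: "N = Suc K" by (cases N) auto
  have top: "F (Suc K) = UNIV" "F K \<noteq> UNIV"
    using \<open>F N = UNIV\<close> not_less_Least[of K "\<lambda>k. F k = UNIV"] K by (auto simp: N_def)
  \<comment> \<open>Needed at the end: the endomorphism built below has kernel containing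
    \<open>F K\<close>, so it is not injective.\<close>
  have "F K \<noteq> {0}"
  proof
    assume "F K = {0}"
    then have "F (Suc K) \<subseteq> V" by (auto simp: F_Suc)
    with top \<open>V \<noteq> UNIV\<close> show False by auto
  qed
  define P where "P k = ((**) G ^^ k) (mat 1)" for k
  have P_0: "P 0 *v v = v" and P_Suc: "P (Suc k) *v v = G *v (P k *v v)" for k v
    unfolding P_def by (simp, rule mat_pow_vec)
  have P_F: "P k *v v \<in> F (Suc k)" if "v \<in> V" for v k
    by (induction k) (use that V_F G_F in \<open>auto simp: P_0 P_Suc\<close>)
  \<comment> \<open>Surjectivity of the map from V to \<open>F (Suc k)\<close> modulo
    \<open>F k\<close> induced by the k-th power of G.\<close>
  have decomp: "\<exists>v\<in>V. x - P k *v v \<in> F k" if "x \<in> F (Suc k)" for x k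
    using that
  proof (induction k arbitrary: x)
    case 0
    then show ?case by (auto simp: F_Suc F_0 P_0)
  next
    case (Suc k)
    then obtain v w where x: "x = v + G *v w" "v \<in> V" "w \<in> F (Suc k)" by (auto simp: F_Suc[of "Suc k"])
    with Suc obtain u where u: "u \<in> V" "w - P k *v u \<in> F k" by blast
    have "x - P (Suc k) *v u = v + G *v (w - P k *v u)"
      by (simp add: x P_Suc algebra_simps)
    also have "\<dots> \<in> F (Suc k)" unfolding F_Suc using u x by blast
    finally show ?case using u by blast
  qed
  \<comment> \<open>The same map is D-linear.\<close>
  have comm: "A *v (P k *v v) - P k *v (A *v v) \<in> F k" if "A \<in> D" "v \<in> V" for A v k
  proof (induction k)
    case 0
    show ?case by (simp add: P_0 F_0)
  next
    case (Suc k)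
    have "A *v (P (Suc k) *v v) - P (Suc k) *v (A *v v) =
        G *v (A *v (P k *v v) - P k *v (A *v v)) - commutator G A *v (P k *v v)"
      by (simp add: P_Suc commutator_vec algebra_simps)
    moreover have "G *v (A *v (P k *v v) - P k *v (A *v v)) \<in> F (Suc k)" using Suc G_F by blast
    moreover have "commutator G A *v (P k *v v) \<in> F (Suc k)" using that closed F_inv P_F by blast
    ultimately show ?case using F_sub by (metis vec.subspace_diff)
  qed
  \<comment> \<open>The kernel of the map from V to the quotient by \<open>F K\<close>. It is a
    submodule of the simple module V, and it is not V since otherwise surjectivity would make
    \<open>F K\<close> everything; hence it is zero.\<close>
  define V0 where "V0 = {v \<in> V. P K *v v \<in> F K}"
  have "invariant_subspace D V0"
    unfolding invariant_subspace_def
  proof (intro conjI ballI)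
    show "vec.subspace V0"
      using V_sub F_sub[of K]
      by (auto simp: V0_def vec.subspace_def algebra_simps vec.scale)
    fix A v assume A: "A \<in> D" "v \<in> V0"
    then have "A *v (P K *v v) - (A *v (P K *v v) - P K *v (A *v v)) \<in> F K"
      using comm F_sub F_inv unfolding V0_def by (blast intro: vec.subspace_diff)
    then show "A *v v \<in> V0" using A V_inv by (auto simp: V0_def)
  qed
  moreover have "V0 \<noteq> V"
  proof
    assume "V0 = V"
    have "x \<in> F K" for x
    proof -
      obtain v where "v \<in> V" "x - P K *v v \<in> F K" using decomp[of x K] top by auto
      then have "(x - P K *v v) + P K *v v \<in> F K"
        using \<open>V0 = V\<close> F_sub unfolding V0_def by (blast intro: vec.subspace_add)
      then show ?thesis by simp
    qed
    with top show False by auto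
  qed
  ultimately have "V0 = {0}" using min_eq[of V0] by (auto simp: V0_def)
  then have inj: "v = 0" if "v \<in> V" "P K *v v \<in> F K" for v
    using that by (auto simp: V0_def)
  \<comment> \<open>f is the quotient map by \<open>F K\<close> followed by the inverse of the
    isomorphism from V.\<close>
  have "\<forall>x. \<exists>v. v \<in> V \<and> x - P K *v v \<in> F K" using decomp[of _ K] top by auto
  then obtain f where f: "\<And>x. f x \<in> V" "\<And>x. x - P K *v f x \<in> F K" by metis
  have unique: "f x = v" if "v \<in> V" "x - P K *v v \<in> F K" for x v
  proof -
    have "(x - P K *v v) - (x - P K *v f x) \<in> F K"
      using that f F_sub by (blast intro: vec.subspace_diff)
    then have "P K *v (f x - v) \<in> F K" by (simp add: algebra_simps)
    moreover have "f x - v \<in> V" using that f V_sub by (blast intro: vec.subspace_diff)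
    ultimately show ?thesis using inj[of "f x - v"] by simp
  qed
  have "Vector_Spaces.linear (*s) (*s) f"
  proof (unfold Vector_Spaces.linear_iff, intro conjI allI)
    fix x y c
    have "(x - P K *v f x) + (y - P K *v f y) \<in> F K"
      using f F_sub by (blast intro: vec.subspace_add)
    then show "f (x + y) = f x + f y"
      using f V_sub by (intro unique) (auto simp: algebra_simps intro: vec.subspace_add)
    have "c *s (x - P K *v f x) \<in> F K"
      using f F_sub by (blast intro: vec.subspace_scale)
    then show "f (c *s x) = c *s f x"
      using f V_sub by (intro unique) (auto simp: algebra_simps vec.scale intro: vec.subspace_scale)
  qed unfold_locales
  then have X: "matrix f *v x = f x" for x by (rule matrix_works)
  have "matrix f ** A = A ** matrix f" if "A \<in> D" for A
  proof -
    have "f (A *v x) = A *v f x" for x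
    proof (rule unique)
      show "A *v f x \<in> V" using that V_inv f by blast
      have "A *v (x - P K *v f x) + (A *v (P K *v f x) - P K *v (A *v f x)) \<in> F K"
        using that F_sub comm f F_inv by (blast intro: vec.subspace_add)
      then show "A *v x - P K *v (A *v f x) \<in> F K" by (simp add: algebra_simps)
    qed
    then show ?thesis by (simp add: matrix_eq X flip: matrix_vector_mul_assoc)
  qed
  then obtain c where c: "matrix f = mat c"
    using commutant_trivial[OF irr closed] by blast
  then have fc: "f x = c *s x" for x using X[of x] by (simp add: mat_mult_vec)
  \<comment> \<open>f kills w, so the scalar is zero; but f = 0 would put every x into
    \<open>F K\<close>.\<close>
  obtain w where w: "w \<in> F K" "w \<noteq> 0" using \<open>F K \<noteq> {0}\<close> zero by blast
  then have "f w = 0" using zero by (intro unique) auto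
  with fc w have "c = 0" by auto
  have "x \<in> F K" for x using f(2)[of x] fc \<open>c = 0\<close> by simp
  with top show False by auto
qed

subsection \<open>Adjoints, quadratic forms and the generator\<close>

lemma matrix_sum_vec: "(\<Sum>i\<in>I. A i) *v v = (\<Sum>i\<in>I. A i *v v)" for A :: "'i \<Rightarrow> 'a::ring_1 ^ 'm ^ 'n"
  by (induction I rule: infinite_finite_induct) (simp_all add: matrix_vector_mult_add_rdistrib)

lemma matrix_scaleR_vec: "(c *\<^sub>R A) *v v = c *\<^sub>R (A *v v)" for A :: "'a::real_algebra_1 ^ 'm ^ 'n"
  by (simp add: vec_eq_iff matrix_vector_mult_def scaleR_sum_right)

lemma matrix_minus_vec: "(- A) *v v = - (A *v v)" for A :: "'a::ring_1 ^ 'm ^ 'n"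
  by (simp add: vec_eq_iff matrix_vector_mult_def sum_negf)

lemma adj_nth: "adj A $ i $ j = cnj (A $ j $ i)"
  by (simp add: adj_def transpose_def)

lemma adj_adj: "adj (adj A) = A"
  by (simp add: vec_eq_iff adj_nth)

lemma adj_mult: "adj (A ** B) = adj B ** adj A"
  by (simp add: vec_eq_iff adj_nth matrix_matrix_mult_def mult.commute)

lemma adj_add: "adj (A + B) = adj A + adj B"
  by (simp add: vec_eq_iff adj_nth)

lemma adj_diff: "adj (A - B) = adj A - adj B"
  by (simp add: vec_eq_iff adj_nth)

lemma adj_minus: "adj (- A) = - adj A"
  by (simp add: vec_eq_iff adj_nth)

lemma adj_scaleR: "adj (c *\<^sub>R A) = c *\<^sub>R adj A"
  by (simp add: vec_eq_iff adj_nth)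

lemma adj_sum: "adj (\<Sum>i\<in>I. A i) = (\<Sum>i\<in>I. adj (A i))"
  by (simp add: vec_eq_iff adj_nth)

lemma adj_one: "adj (mat 1) = mat 1"
  by (simp add: vec_eq_iff adj_nth mat_def)

lemma cnj_cinner: "cnj (cinner u v) = cinner v u"
  by (simp add: cinner_def mult.commute)

lemma Re_cinner: "Re (cinner u v) = u \<bullet> v"
  by (simp add: cinner_def inner_vec_def inner_complex_def)

lemma cinner_adj: "cinner u (A *v v) = cinner (adj A *v u) v"
proof -
  have "cinner u (A *v v) = (\<Sum>i\<in>UNIV. \<Sum>j\<in>UNIV. cnj (u $ i) * A $ i $ j * v $ j)"
    by (simp add: cinner_def matrix_vector_mult_def sum_distrib_left mult.assoc)
  also have "\<dots> = (\<Sum>j\<in>UNIV. \<Sum>i\<in>UNIV. cnj (u $ i) * A $ i $ j * v $ j)"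
    by (rule sum.swap)
  also have "\<dots> = cinner (adj A *v u) v"
    by (simp add: cinner_def matrix_vector_mult_def sum_distrib_left sum_distrib_right adj_nth mult_ac)
  finally show ?thesis .
qed

lemma inner_adj: "u \<bullet> (A *v v) = (adj A *v u) \<bullet> v"
  using cinner_adj by (metis Re_cinner)

text \<open>Self-adjointness makes the Hermitian form real, so positivity can be studied with the
  real inner product.\<close>

lemma positive_iff_inner:
  assumes "adj A = A"
  shows "positive A \<longleftrightarrow> (\<forall>v. 0 \<le> v \<bullet> (A *v v))"
proof -
  have "cnj (cinner v (A *v v)) = cinner v (A *v v)" for v
    by (simp add: cnj_cinner) (simp add: cinner_adj assms)
  then have "Im (cinner v (A *v v)) = 0" for v
    by (simp add: complex_eq_iff)
  then show ?thesis
    by (simp add: positive_def complex_nonneg_Reals_iff Re_cinner)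
qed

lemma positive_kernel:
  assumes A: "adj A = A" and pos: "\<And>u. 0 \<le> u \<bullet> (A *v u)" and v: "v \<bullet> (A *v v) = 0"
  shows "A *v v = 0"
proof (rule ccontr)
  define w where "w = A *v v"
  define a b where "a = w \<bullet> w" and "b = w \<bullet> (A *v w)"
  \<comment> \<open>The form at v - c w is -2ca + c^2 b. With a = c(b + 1) this is -c^2 (b + 2) < 0;
    the summand 1 keeps the denominator positive when b = 0.\<close>
  define c where "c = a / (b + 1)"
  assume "A *v v \<noteq> 0"
  then have "a > 0" by (simp add: a_def w_def)
  have "b \<ge> 0" unfolding b_def by (rule pos)
  have "v \<bullet> (A *v w) = a" by (simp add: inner_adj A a_def flip: w_def)
  moreover have "A *v (c *\<^sub>R w) = c *\<^sub>R (A *v w)"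
    by (rule linear_cmul[OF matrix_vector_mul_linear])
  ultimately have "(v - c *\<^sub>R w) \<bullet> (A *v (v - c *\<^sub>R w)) = - 2 * c * a + c\<^sup>2 * b"
    using v by (simp add: matrix_vector_mult_diff_distrib inner_diff_left inner_diff_right
        a_def b_def power2_eq_square algebra_simps flip: w_def)
  also have "a = c * (b + 1)" using \<open>b \<ge> 0\<close> by (simp add: c_def)
  finally have "(v - c *\<^sub>R w) \<bullet> (A *v (v - c *\<^sub>R w)) = - (c\<^sup>2 * (b + 2))"
    by (simp add: power2_eq_square algebra_simps)
  moreover have "c\<^sup>2 * (b + 2) > 0" using \<open>a > 0\<close> \<open>b \<ge> 0\<close> by (simp add: c_def)
  ultimately show False using pos[of "v - c *\<^sub>R w"] by simp
qed

section \<open>The exponential semigroup and its derivative\<close>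

lemma exp_semigroup_commute:
  fixes \<Phi> :: "'a::euclidean_space \<Rightarrow> 'a"
  assumes "linear \<Phi>" and f: "linear f" "\<And>x. f (\<Phi> x) = \<Phi> (f x)"
  shows "f (exp_semigroup \<Phi> t x) = exp_semigroup \<Phi> t (f x)"
proof -
  have "f ((\<Phi> ^^ k) x) = (\<Phi> ^^ k) (f x)" for k
    by (induction k) (simp_all add: f)
  then show ?thesis
    unfolding exp_semigroup_def
    using bounded_linear.suminf[of f, OF linear_conv_bounded_linear[THEN iffD1, OF f(1)]
        summable_exp_semigroup[OF assms(1)]]
    by (simp add: linear_cmul[OF f(1)])
qed

lemma exp_semigroup_0: "exp_semigroup \<Phi> 0 x = x"
  unfolding exp_semigroup_def by (subst suminf_finite[of "{0}"]) auto

text \<open>Each coordinate is a real power series in t. Termwise differentiation shifts its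
  coefficients, which amounts to replacing x by \<Phi> x.\<close>

lemma exp_semigroup_has_vector_derivative:
  fixes \<Phi> :: "'a::euclidean_space \<Rightarrow> 'a"
  assumes "linear \<Phi>"
  shows "((\<lambda>t. exp_semigroup \<Phi> t x) has_vector_derivative \<Phi> (exp_semigroup \<Phi> t x)) (at t within S)"
proof -
  have comp: "((\<lambda>t. exp_semigroup \<Phi> t x \<bullet> b) has_real_derivative \<Phi> (exp_semigroup \<Phi> t x) \<bullet> b) (at t)" for b
  proof -
    define c where "c y k = ((\<Phi> ^^ k) y \<bullet> b) / fact k" for y k
    have summable: "summable (\<lambda>k. c y k * s ^ k)" and eq: "exp_semigroup \<Phi> s y \<bullet> b = (\<Sum>k. c y k * s ^ k)"
      for y s
      using bounded_linear.summable[OF bounded_linear_inner_left[of b] summable_exp_semigroup[OF assms, of s y]]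
        bounded_linear.suminf[OF bounded_linear_inner_left[of b] summable_exp_semigroup[OF assms, of s y]]
      by (simp_all add: c_def exp_semigroup_def mult.commute)
    have "diffs (c x) = c (\<Phi> x)"
      by (rule ext) (simp add: diffs_def c_def funpow_swap1 del: of_nat_Suc)
    moreover have "\<Phi> (exp_semigroup \<Phi> t x) \<bullet> b = (\<Sum>k. c (\<Phi> x) k * t ^ k)"
      by (simp add: exp_semigroup_commute[OF assms assms] eq)
    ultimately show ?thesis
      using termdiffs_strong_converges_everywhere[of "c x" t] summable by (simp add: eq)
  qed
  then have "((\<lambda>t. exp_semigroup \<Phi> t x) has_vector_derivative \<Phi> (exp_semigroup \<Phi> t x)) (at t)"
    unfolding has_vector_derivative_def
    by (subst has_derivative_componentwise_within) (simp add: has_field_derivative_def mult_commute_abs)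
  then show ?thesis by (rule has_vector_derivative_at_within)
qed

context
  fixes L :: "nat \<Rightarrow> complex ^ 'n ^ 'n" and H :: "complex ^ 'n ^ 'n" and m :: nat
begin

lemma adj_generator: "adj (generator m L H x) = generator m L H (adj x)"
  by (simp add: generator_def adj_add adj_sum adj_mult adj_adj matrix_mul_assoc add_ac)

lemma adj_qms: "adj (qms m L H t x) = qms m L H t (adj x)"
  unfolding qms_def
  by (rule exp_semigroup_commute)
    (simp_all add: linear_generator linearI adj_add adj_scaleR adj_generator)

lemma qms_has_vector_derivative:
  "((\<lambda>t. qms m L H t x) has_vector_derivative generator m L H (qms m L H t x)) (at t within S)"
  unfolding qms_def by (rule exp_semigroup_has_vector_derivative[OF linear_generator])

text \<open>For self-adjoint x the two G terms are complex conjugates, so their real parts agree;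
  this gives the factor 2.\<close>

lemma inner_generator:
  assumes "adj x = x"
  shows "v \<bullet> (generator m L H x *v v) =
    (\<Sum>l=1..m. (L l *v v) \<bullet> (x *v (L l *v v))) + 2 * ((G_op m L H *v v) \<bullet> (x *v v))"
  by (simp add: generator_def matrix_vector_mult_add_rdistrib inner_add_right matrix_sum_vec inner_sum_right
      inner_adj[of _ "adj _"] inner_adj[of v x] assms inner_commute adj_adj flip: matrix_vector_mul_assoc)

text \<open>The iH parts of G and its adjoint cancel, and the two halves of the sum of
  \<open>adj (L l) ** L l\<close> cancel the middle term. Thus the semigroup preserves the
  identity.\<close>

lemma generator_one:
  assumes "adj H = H"
  shows "generator m L H (mat 1) = 0"
proof -
  let ?S = "\<Sum>l=1..m. adj (L l) ** L l"
  have "adj (map_matrix (\<lambda>z. \<i> * z) H) = - map_matrix (\<lambda>z. \<i> * z) (adj H)"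
    by (simp add: vec_eq_iff adj_nth)
  then have "adj (G_op m L H) = - ((1 / 2) *\<^sub>R ?S) + map_matrix (\<lambda>z. \<i> * z) H"
    using assms by (simp add: G_op_def adj_diff adj_minus adj_scaleR adj_sum adj_mult adj_adj)
  then have "generator m L H (mat 1) = ?S - ((1 / 2) *\<^sub>R ?S + (1 / 2) *\<^sub>R ?S)"
    by (simp add: generator_def G_op_def)
  also have "(1 / 2) *\<^sub>R ?S + (1 / 2) *\<^sub>R ?S = ?S"
    by (simp flip: scaleR_add_left)
  finally show ?thesis by simp
qed

end

subsection \<open>Subharmonic projections\<close>

lemma continuous_on_quadratic_form:
  fixes Y :: "real \<Rightarrow> complex ^ 'n ^ 'n"
  assumes "continuous_on S Y"
  shows "continuous_on (S \<times> UNIV) (\<lambda>(t, v). v \<bullet> (Y t *v v))"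
proof -
  have "continuous_on (S \<times> UNIV) (\<lambda>z. Y (fst z))"
    by (rule continuous_on_compose2[OF assms continuous_on_fst]) (auto intro: continuous_on_id)
  then have "continuous_on (S \<times> UNIV) (\<lambda>z. Y (fst z) *v snd z)"
    unfolding matrix_vector_mult_def
    by (intro continuous_on_vec_lambda continuous_on_sum continuous_on_mult continuous_on_component continuous_intros)
  then show ?thesis
    unfolding case_prod_unfold by (intro continuous_intros)
qed

lemma has_real_derivative_quadratic_form:
  fixes Y :: "real \<Rightarrow> complex ^ 'n ^ 'n"
  assumes "(Y has_vector_derivative Y') (at t)"
  shows "((\<lambda>t. v \<bullet> (Y t *v v)) has_real_derivative v \<bullet> (Y' *v v)) (at t)"
proof -
  have "linear (\<lambda>A :: complex ^ 'n ^ 'n. v \<bullet> (A *v v))"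
    by (rule linearI)
      (simp_all add: matrix_vector_mult_add_rdistrib inner_add_right matrix_scaleR_vec)
  then have "bounded_linear (\<lambda>A :: complex ^ 'n ^ 'n. v \<bullet> (A *v v))"
    by (simp add: linear_conv_bounded_linear)
  from bounded_linear.has_vector_derivative[OF this assms] show ?thesis
    by (simp add: has_real_derivative_iff_has_vector_derivative)
qed

lemma quadratic_form_nonneg_if_unit:
  fixes A :: "complex ^ 'n ^ 'n"
  assumes "\<And>u. norm u = 1 \<Longrightarrow> 0 \<le> u \<bullet> (A *v u)"
  shows "0 \<le> v \<bullet> (A *v v)"
proof (cases "v = 0")
  case False
  define e where "e = (1 / norm v) *\<^sub>R v"
  have "v = norm v *\<^sub>R e" using False by (simp add: e_def)
  moreover have "A *v (norm v *\<^sub>R e) = norm v *\<^sub>R (A *v e)"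
    by (rule linear_cmul[OF matrix_vector_mul_linear])
  ultimately have "v \<bullet> (A *v v) = (norm v)\<^sup>2 * (e \<bullet> (A *v e))"
    by (metis inner_scaleR_left inner_scaleR_right mult.assoc power2_eq_square)
  moreover have "norm e = 1" using False by (simp add: e_def)
  ultimately show ?thesis using assms by simp
qed simp

text \<open>
  At the first time at which the form \<open>Y t\<close> acquires a null vector \<open>v\<close>, the derivative of
  \<open>\<lambda>t. v \<bullet> Y t v\<close> would have to be nonpositive.
\<close>

lemma quadratic_form_stays_pos:
  fixes Y :: "real \<Rightarrow> complex ^ 'n ^ 'n"
  assumes deriv: "\<And>t. (Y has_vector_derivative Y' t) (at t)"
    and herm: "\<And>t. adj (Y t) = Y t"
    and init: "\<And>v. v \<noteq> 0 \<Longrightarrow> 0 < v \<bullet> (Y 0 *v v)"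
    and inward: "\<And>t v. 0 < t \<Longrightarrow> (\<And>u. 0 \<le> u \<bullet> (Y t *v u)) \<Longrightarrow> v \<noteq> 0 \<Longrightarrow> Y t *v v = 0 \<Longrightarrow>
      0 < v \<bullet> (Y' t *v v)"
    and "0 \<le> t" "norm v = 1"
  shows "0 < v \<bullet> (Y t *v v)"
proof (rule ccontr)
  assume neg: "\<not> 0 < v \<bullet> (Y t *v v)"
  \<comment> \<open>The times and unit vectors at which positivity fails. K is compact, so it has a
    point (s, w) of least time.\<close>
  define K where "K = {z \<in> {0..t} \<times> sphere 0 1. (\<lambda>(t, v). v \<bullet> (Y t *v v)) z \<le> 0}"
  have "continuous_on S Y" for S
    by (intro continuous_at_imp_continuous_on ballI has_vector_derivative_continuous[OF deriv])
  then have "continuous_on ({0..t} \<times> sphere 0 1) (\<lambda>(t, v). v \<bullet> (Y t *v v))"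
    by (rule continuous_on_subset[OF continuous_on_quadratic_form]) auto
  then have "closed K"
    unfolding K_def by (intro continuous_on_closed_Collect_le continuous_on_const closed_Times) auto
  moreover have "compact ({0..t} \<times> sphere (0 :: complex ^ 'n) 1)" by (intro compact_Times) auto
  ultimately have "compact K"
    using compact_Int_closed[of "{0..t} \<times> sphere (0 :: complex ^ 'n) 1" K] by (auto simp: K_def Int_absorb1)
  moreover have "(t, v) \<in> K" using neg assms by (simp add: K_def)
  ultimately obtain z where z: "z \<in> K" "\<And>y. y \<in> K \<Longrightarrow> fst z \<le> fst y"
    using continuous_attains_inf[of K fst] continuous_on_fst[OF continuous_on_id] by blast
  define s w where "s = fst z" and "w = snd z"
  have s: "0 \<le> s" "s \<le> t" "norm w = 1" "w \<bullet> (Y s *v w) \<le> 0"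
    using z by (auto simp: K_def s_def w_def)
  have "w \<noteq> 0" using s by auto
  have "s \<noteq> 0" using init[OF \<open>w \<noteq> 0\<close>] s by auto
  with s have "s > 0" by simp
  have before: "0 < u \<bullet> (Y r *v u)" if "0 \<le> r" "r < s" "norm u = 1" for r u
    using z(2)[of "(r, u)"] that s by (force simp: K_def s_def)
  \<comment> \<open>Positivity before s survives in the limit from the left, so w is a null vector
    of a nonnegative form.\<close>
  have unit_nonneg: "0 \<le> u \<bullet> (Y s *v u)" if "norm u = 1" for u
  proof (rule tendsto_lowerbound)
    have "isCont (\<lambda>r. u \<bullet> (Y r *v u)) s"
      using DERIV_isCont has_real_derivative_quadratic_form deriv by blast
    then show "((\<lambda>r. u \<bullet> (Y r *v u)) \<longlongrightarrow> u \<bullet> (Y s *v u)) (at_left s)"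
      by (auto simp: isCont_def intro: filterlim_at_split[THEN iffD1, THEN conjunct1])
    show "\<forall>\<^sub>F r in at_left s. 0 \<le> u \<bullet> (Y r *v u)"
      using eventually_at_left_real[OF \<open>s > 0\<close>]
      by eventually_elim (use before that in \<open>auto intro!: less_imp_le\<close>)
  qed simp
  have nonneg: "0 \<le> u \<bullet> (Y s *v u)" for u
    using unit_nonneg by (rule quadratic_form_nonneg_if_unit)
  have "w \<bullet> (Y s *v w) = 0" using s(4) nonneg[of w] by simp
  then have "Y s *v w = 0" using positive_kernel[OF herm nonneg] by blast
  then have "0 < w \<bullet> (Y' s *v w)" using inward \<open>s > 0\<close> nonneg \<open>w \<noteq> 0\<close> by blast
  \<comment> \<open>A positive derivative at s forces negative values just before s, where the form
    is still positive.\<close>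
  from has_real_derivative_pos_inc_left[OF has_real_derivative_quadratic_form[OF deriv] this]
  obtain d where d: "d > 0" "\<And>h. 0 < h \<Longrightarrow> h < d \<Longrightarrow> w \<bullet> (Y (s - h) *v w) < w \<bullet> (Y s *v w)"
    by auto
  define h where "h = min s d / 2"
  have "0 < h" "h < d" "h \<le> s" using \<open>s > 0\<close> \<open>d > 0\<close> by (auto simp: h_def)
  then have "w \<bullet> (Y (s - h) *v w) < 0" using d(2)[of h] s by simp
  moreover have "0 < w \<bullet> (Y (s - h) *v w)" using before s \<open>0 < h\<close> \<open>h \<le> s\<close> by simp
  ultimately show False by simp
qed

context
  fixes L :: "nat \<Rightarrow> complex ^ 'n ^ 'n" and H :: "complex ^ 'n ^ 'n" and m :: nat
  assumes H: "adj H = H"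
begin


text \<open>Adding a e^s to T_s(p) - p makes the form positive at s = 0. As the generator kills the
  identity, the derivative is the generator at \<open>Y s\<close>, plus the generator at p, plus a
  e^s; at a null vector of \<open>Y s\<close> the first two contribute nonnegatively and the last
  one strictly.\<close>

lemma qms_ge_if_generator_nonneg:
  assumes p: "adj p = p" and pos: "\<And>v. 0 \<le> v \<bullet> (generator m L H p *v v)" and "0 \<le> t"
  shows "0 \<le> v \<bullet> ((qms m L H t p - p) *v v)"
proof -
  interpret gen: linear "generator m L H" by (rule linear_generator)
  have unit: "0 \<le> v \<bullet> ((qms m L H t p - p) *v v)" if "norm v = 1" for v
  proof (rule field_le_epsilon)
    fix e :: real assume "0 < e"
    \<comment> \<open>Chosen so that the perturbation equals e at the final time t.\<close>
    define a where "a = e / exp t"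
    have "a > 0" using \<open>0 < e\<close> by (simp add: a_def)
    define Y where "Y s = qms m L H s p - p + (a * exp s) *\<^sub>R mat 1" for s
    define Y' where "Y' s = generator m L H (qms m L H s p) + (a * exp s) *\<^sub>R mat 1" for s
    have gen_Y: "generator m L H (Y s) = generator m L H (qms m L H s p) - generator m L H p" for s
      by (simp add: Y_def gen.add gen.diff gen.scaleR generator_one[OF H])
    have quad_one: "u \<bullet> ((c *\<^sub>R mat 1) *v u) = c * (u \<bullet> u)" for c and u :: "complex ^ 'n"
      by (simp add: matrix_scaleR_vec)
    have "0 < v \<bullet> (Y t *v v)"
    proof (rule quadratic_form_stays_pos[where Y' = Y'])
      show "(Y has_vector_derivative Y' s) (at s)" for s
        unfolding Y_def Y'_def
        by (auto intro!: derivative_eq_intros qms_has_vector_derivative)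
      show Y_herm: "adj (Y s) = Y s" for s
        by (simp add: Y_def adj_add adj_diff adj_scaleR adj_one adj_qms p)
      show "0 < u \<bullet> (Y 0 *v u)" if "u \<noteq> 0" for u
        using that \<open>a > 0\<close> by (simp add: Y_def qms_def exp_semigroup_0 quad_one)
      show "0 < u \<bullet> (Y' s *v u)"
        if Y_pos: "\<And>u. 0 \<le> u \<bullet> (Y s *v u)" and u: "u \<noteq> 0" "Y s *v u = 0" for s u
      proof -
        have "Y' s = generator m L H (Y s) + generator m L H p + (a * exp s) *\<^sub>R mat 1"
          by (simp add: Y'_def gen_Y)
        then have "u \<bullet> (Y' s *v u) =
            u \<bullet> (generator m L H (Y s) *v u) + u \<bullet> (generator m L H p *v u) + a * exp s * (u \<bullet> u)"
          by (simp add: matrix_vector_mult_add_rdistrib inner_add_right quad_one)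
        \<comment> \<open>The G term of \<open>inner_generator\<close> vanishes at a null vector,
          and the others are values of the nonnegative form \<open>Y s\<close>.\<close>
        moreover have "0 \<le> u \<bullet> (generator m L H (Y s) *v u)"
          using u(2) by (simp add: inner_generator[OF Y_herm] Y_pos sum_nonneg)
        moreover have "0 < a * exp s * (u \<bullet> u)" using \<open>a > 0\<close> u by simp
        ultimately show ?thesis using pos[of u] by simp
      qed
    qed (use \<open>0 \<le> t\<close> that in auto)
    moreover have "v \<bullet> (Y t *v v) = v \<bullet> ((qms m L H t p - p) *v v) + e"
      using that by (simp add: Y_def matrix_vector_mult_add_rdistrib inner_add_right quad_one a_def
          dot_square_norm)
    ultimately show "0 \<le> v \<bullet> ((qms m L H t p - p) *v v) + e" by simp
  qed
  then show ?thesis by (rule quadratic_form_nonneg_if_unit)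
qed

text \<open>T_t(p) - p vanishes at t = 0, so if it stays nonnegative its derivative there, the
  generator at p, is nonnegative.\<close>

lemma subharmonic_iff_generator:
  "subharmonic (qms m L H) p \<longleftrightarrow> projection p \<and> (\<forall>v. 0 \<le> v \<bullet> (generator m L H p *v v))"
proof (cases "projection p")
  case True
  then have p: "adj p = p" by (simp add: projection_def)
  have sub: "subharmonic (qms m L H) p \<longleftrightarrow> (\<forall>t\<ge>0. \<forall>v. 0 \<le> v \<bullet> ((qms m L H t p - p) *v v))"
    using True by (simp add: subharmonic_def loewner_le_def positive_iff_inner adj_diff adj_qms p)
  have "0 \<le> v \<bullet> (generator m L H p *v v)" if "subharmonic (qms m L H) p" for v
  proof (rule ccontr)
    assume "\<not> 0 \<le> v \<bullet> (generator m L H p *v v)"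
    then have neg: "v \<bullet> (generator m L H (qms m L H 0 p) *v v) < 0" by (simp add: qms_def exp_semigroup_0)
    from has_real_derivative_neg_dec_right[OF has_real_derivative_quadratic_form[OF qms_has_vector_derivative] neg]
    obtain d where d: "d > 0"
      "\<And>h. 0 < h \<Longrightarrow> h < d \<Longrightarrow> v \<bullet> (qms m L H (0 + h) p *v v) < v \<bullet> (qms m L H 0 p *v v)"
      by auto
    then have "v \<bullet> (qms m L H (d / 2) p *v v) < v \<bullet> (p *v v)"
      using d(2)[of "d / 2"] by (simp add: qms_def exp_semigroup_0)
    moreover have "0 \<le> v \<bullet> ((qms m L H (d / 2) p - p) *v v)" using that sub \<open>d > 0\<close> by simp
    ultimately show False by (simp add: matrix_vector_mult_diff_rdistrib inner_diff_right)
  qed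
  then show ?thesis using True sub qms_ge_if_generator_nonneg[OF p] by blast
qed (simp add: subharmonic_def)

text \<open>Since the generator kills the identity, p can be traded for 1 - p up to sign. On the
  range of p only minus a sum of squares remains.\<close>

lemma generator_complement:
  assumes "projection p"
  shows "v \<bullet> (generator m L H p *v v) =
    - (\<Sum>l=1..m. (norm ((mat 1 - p) *v (L l *v v)))\<^sup>2) - 2 * ((G_op m L H *v v) \<bullet> ((mat 1 - p) *v v))"
proof -
  interpret gen: linear "generator m L H" by (rule linear_generator)
  let ?q = "mat 1 - p"
  have q: "adj ?q = ?q" "?q ** ?q = ?q"
    using assms by (auto simp: projection_def adj_diff adj_one matrix_diff_ldistrib matrix_diff_rdistrib)
  have "u \<bullet> (?q *v u) = (norm (?q *v u))\<^sup>2" for u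
  proof -
    have "u \<bullet> (?q *v u) = u \<bullet> (?q *v (?q *v u))" by (simp only: matrix_vector_mul_assoc q)
    then show ?thesis by (simp only: inner_adj q(1) power2_norm_eq_inner)
  qed
  moreover have "generator m L H p = - generator m L H ?q" by (simp add: gen.diff generator_one[OF H])
  ultimately show ?thesis using inner_generator[OF q(1), of v m L H] by (simp add: matrix_minus_vec)
qed

lemma subharmonic_iff_invariant:
  assumes p: "projection p"
  shows "subharmonic (qms m L H) p \<longleftrightarrow>
    (\<forall>A\<in>insert (G_op m L H) (L ` {1..m}). \<forall>v. p *v v = v \<longrightarrow> p *v (A *v v) = A *v v)"
    (is "_ \<longleftrightarrow> ?inv")
proof
  interpret gen: linear "generator m L H" by (rule linear_generator)
  let ?q = "mat 1 - p"
  have q: "?q *v u = u - p *v u" for u by (simp add: matrix_vector_mult_diff_rdistrib)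
  have herm: "adj p = p" using p by (simp add: projection_def)
  assume "subharmonic (qms m L H) p"
  then have pos: "0 \<le> v \<bullet> (generator m L H p *v v)" for v by (simp add: subharmonic_iff_generator)
  show ?inv
  proof (intro ballI allI impI)
    fix A v assume A: "A \<in> insert (G_op m L H) (L ` {1..m})" and v: "p *v v = v"
    have eq: "v \<bullet> (generator m L H p *v v) = - (\<Sum>l=1..m. (norm (?q *v (L l *v v)))\<^sup>2)"
      using v by (simp add: generator_complement[OF p] q)
    then have "(\<Sum>l=1..m. (norm (?q *v (L l *v v)))\<^sup>2) \<le> 0" using pos[of v] by simp
    then have sum0: "(\<Sum>l=1..m. (norm (?q *v (L l *v v)))\<^sup>2) = 0"
      by (intro antisym sum_nonneg) auto
    then have qL: "?q *v (L l *v v) = 0" if "l \<in> {1..m}" for l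
      using that by (subst (asm) sum_nonneg_eq_0_iff) auto
    \<comment> \<open>The squares vanish, so v is a null vector of a nonnegative form and hence in
      its kernel. This is what yields information about G.\<close>
    have "generator m L H p *v v = 0"
    proof (rule positive_kernel[OF _ pos])
      show "adj (generator m L H p) = generator m L H p" by (simp add: adj_generator herm)
      show "v \<bullet> (generator m L H p *v v) = 0" unfolding eq sum0 by simp
    qed
    moreover have "generator m L H p = - generator m L H ?q" by (simp add: gen.diff generator_one[OF H])
    ultimately have "generator m L H ?q *v v = 0" by (simp add: matrix_minus_vec)
    moreover have "generator m L H ?q *v v =
        adj (G_op m L H) *v (?q *v v) + (\<Sum>l=1..m. adj (L l) *v (?q *v (L l *v v))) + ?q *v (G_op m L H *v v)"
      by (simp only: generator_def matrix_vector_mult_add_rdistrib matrix_sum_vec matrix_vector_mul_assoc matrix_mul_assoc)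
    ultimately have "?q *v (G_op m L H *v v) = 0" using qL v by (simp add: q)
    with qL A show "p *v (A *v v) = A *v v" by (auto simp: q)
  qed
next
  let ?q = "mat 1 - p"
  have q: "?q *v u = u - p *v u" for u by (simp add: matrix_vector_mult_diff_rdistrib)
  have herm: "adj p = p" and idem: "p *v (p *v u) = p *v u" for u
    using p by (auto simp: projection_def matrix_vector_mul_assoc)
  assume inv: ?inv
  \<comment> \<open>Invariance says that q A p = 0, where q = 1 - p.\<close>
  have q_inv: "?q *v (A *v u) = ?q *v (A *v (?q *v u))" if "A \<in> insert (G_op m L H) (L ` {1..m})" for A u
  proof -
    have "p *v (A *v (p *v u)) = A *v (p *v u)" using inv that idem by blast
    then show ?thesis by (simp add: q matrix_vector_mult_diff_distrib)
  qed
  have contr: "(norm (?q *v u))\<^sup>2 \<le> (norm u)\<^sup>2" for u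
  proof -
    have "u \<bullet> (p *v u) = (p *v u) \<bullet> (p *v u)"
      using inner_adj[of u p "p *v u"] by (simp add: herm idem)
    then show ?thesis
      by (simp add: q power2_norm_eq_inner inner_diff_left inner_diff_right inner_commute)
  qed
  have "0 \<le> v \<bullet> (generator m L H p *v v)" for v
  proof -
    define b where "b = ?q *v v"
    have "(\<Sum>l=1..m. (norm (?q *v (L l *v v)))\<^sup>2) \<le> (\<Sum>l=1..m. (norm (L l *v b))\<^sup>2)"
    proof (rule sum_mono)
      fix l assume "l \<in> {1..m}"
      then have "?q *v (L l *v v) = ?q *v (L l *v b)" unfolding b_def by (intro q_inv) auto
      then show "(norm (?q *v (L l *v v)))\<^sup>2 \<le> (norm (L l *v b))\<^sup>2" using contr by simp
    qed
    moreover have "(G_op m L H *v v) \<bullet> b = (G_op m L H *v b) \<bullet> b"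
    proof -
      have qq: "?q *v b = b" by (simp add: b_def q idem matrix_vector_mult_diff_distrib)
      have "u \<bullet> b = (?q *v u) \<bullet> b" for u
        using inner_adj[of u ?q b] by (simp add: qq adj_diff adj_one herm)
      then show ?thesis using q_inv[of "G_op m L H" v] by (metis b_def insertI1)
    qed
    \<comment> \<open>Vanishing of the generator at the identity, tested on b; it balances the G
      term against the bound on the squares.\<close>
    moreover have "(\<Sum>l=1..m. (norm (L l *v b))\<^sup>2) + 2 * ((G_op m L H *v b) \<bullet> b) = 0"
      using inner_generator[OF adj_one, of b m L H] generator_one[OF H, of m L]
      by (simp add: power2_norm_eq_inner)
    ultimately show ?thesis by (simp add: generator_complement[OF p] flip: b_def)
  qed
  then show "subharmonic (qms m L H) p" using p by (simp add: subharmonic_iff_generator)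
qed

end

subsection \<open>The spaces \<open>S(\<xi>)\<close>\<close>

lemma inner_scale_left: "(c *s u) \<bullet> v = u \<bullet> (cnj c *s v)" for u v :: "complex ^ 'n"
  by (simp add: inner_vec_def inner_complex_def algebra_simps)

text \<open>Orthogonal projection for the real inner product. It is complex-linear because a complex
  scalar moves across that product as its conjugate and W is stable under complex scalars.\<close>

lemma ex_projection_onto:
  fixes W :: "(complex ^ 'n) set"
  assumes W: "vec.subspace W"
  obtains p where "projection p" "\<And>v. p *v v = v \<longleftrightarrow> v \<in> W"
proof -
  have "c *\<^sub>R x = complex_of_real c *s x" for c and x :: "complex ^ 'n"
    by (simp add: vec_eq_iff scaleR_conv_of_real[where 'a = complex])
  with W have "subspace W" by (simp add: vec.subspace_def subspace_def)
  have "\<exists>y. y \<in> W \<and> (\<forall>w\<in>W. (x - y) \<bullet> w = 0)" for x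
    using orthogonal_subspace_decomp_exists[of W x] \<open>subspace W\<close>
    by (metis orthogonal_def add_diff_cancel_left' span_eq_iff)
  then obtain f where f: "\<And>x. f x \<in> W" "\<And>x w. w \<in> W \<Longrightarrow> (x - f x) \<bullet> w = 0"
    by metis
  have unique: "f x = y" if "y \<in> W" "\<And>w. w \<in> W \<Longrightarrow> (x - y) \<bullet> w = 0" for x y
  proof -
    have "f x - y \<in> W" using f that \<open>subspace W\<close> by (blast intro: subspace_diff)
    then have "(x - y) \<bullet> (f x - y) - (x - f x) \<bullet> (f x - y) = 0" using f that by simp
    then have "(f x - y) \<bullet> (f x - y) = 0" by (simp flip: inner_diff_left)
    then show ?thesis by simp
  qed
  have "Vector_Spaces.linear (*s) (*s) f"
  proof (unfold Vector_Spaces.linear_iff, intro conjI allI)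
    fix x y c
    show "f (x + y) = f x + f y"
    proof (rule unique)
      show "f x + f y \<in> W" using f W by (blast intro: vec.subspace_add)
      show "(x + y - (f x + f y)) \<bullet> w = 0" if "w \<in> W" for w
        using f(2)[OF that, of x] f(2)[OF that, of y] by (simp add: algebra_simps)
    qed
    show "f (c *s x) = c *s f x"
    proof (rule unique)
      show "c *s f x \<in> W" using f W by (blast intro: vec.subspace_scale)
      show "(c *s x - c *s f x) \<bullet> w = 0" if "w \<in> W" for w
      proof -
        have "(c *s (x - f x)) \<bullet> w = 0"
          unfolding inner_scale_left using that W by (intro f) (rule vec.subspace_scale)
        then show ?thesis by (simp add: vec.scale_right_diff_distrib)
      qed
    qed
  qed unfold_locales
  then have p: "matrix f *v x = f x" for x by (rule matrix_works)
  have fixed: "f v = v \<longleftrightarrow> v \<in> W" for v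
    using f(1)[of v] unique[of v v] by auto
  have "(f x) \<bullet> y = x \<bullet> f y" for x y
    using f(2)[OF f(1), of x y] f(2)[OF f(1), of y x] by (simp add: inner_diff_left inner_diff_right inner_commute)
  then have "(adj (matrix f) *v x) \<bullet> y = (matrix f *v x) \<bullet> y" for x y
    by (simp add: p flip: inner_adj)
  then have "adj (matrix f) = matrix f"
    unfolding matrix_eq by (metis vector_eq_rdot)
  moreover have "matrix f ** matrix f = matrix f"
    using f(1) by (simp add: matrix_eq p fixed flip: matrix_vector_mul_assoc)
  ultimately show thesis
    using that[of "matrix f"] fixed by (simp add: projection_def p)
qed

text \<open>Projections correspond to their fixed spaces, with 0 and \<open>mat 1\<close> matching
  {0} and \<open>UNIV\<close>; subharmonicity becomes invariance.\<close>

lemma irreducible_qms_iff: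
  assumes "adj H = H"
  shows "irreducible_qms (qms m L H) \<longleftrightarrow> irreducible_set (insert (G_op m L H) (L ` {1..m}))"
proof
  assume irr: "irreducible_qms (qms m L H)"
  show "irreducible_set (insert (G_op m L H) (L ` {1..m}))"
    unfolding irreducible_set_def
  proof (intro allI impI)
    fix W assume W: "invariant_subspace (insert (G_op m L H) (L ` {1..m})) W"
    then obtain p where p: "projection p" "\<And>v. p *v v = v \<longleftrightarrow> v \<in> W"
      using ex_projection_onto[of W] by (auto simp: invariant_subspace_def)
    then have "subharmonic (qms m L H) p"
      using W by (simp add: subharmonic_iff_invariant[OF assms] invariant_subspace_def)
    then have "p = 0 \<or> p = mat 1" using irr by (auto simp: irreducible_qms_def)
    moreover have "W = {v. p *v v = v}" using p(2) by simp
    ultimately show "W = {0} \<or> W = UNIV" by (elim disjE) auto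
  qed
next
  assume irr: "irreducible_set (insert (G_op m L H) (L ` {1..m}))"
  have "p = 0 \<or> p = mat 1" if sub: "subharmonic (qms m L H) p" for p
  proof -
    have p: "projection p" using sub by (simp add: subharmonic_def)
    then have idem: "p *v (p *v v) = p *v v" for v
      by (simp add: matrix_vector_mul_assoc projection_def)
    have "vec.subspace {v. p *v v = v}"
      by (auto simp: vec.subspace_def vec.add vec.scale)
    then have "invariant_subspace (insert (G_op m L H) (L ` {1..m})) {v. p *v v = v}"
      using sub by (simp add: subharmonic_iff_invariant[OF assms p] invariant_subspace_def)
    then have "{v. p *v v = v} = {0} \<or> {v. p *v v = v} = UNIV"
      using irr by (simp add: irreducible_set_def)
    then have "(\<forall>v. p *v v = 0) \<or> (\<forall>v. p *v v = v)"
      using idem by blast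
    then show ?thesis by (auto simp: matrix_eq)
  qed
  then show "irreducible_qms (qms m L H)" by (auto simp: irreducible_qms_def)
qed

lemma invariant_subspace_delta:
  assumes "invariant_subspace (insert G D) W" "A \<in> D" "w \<in> W"
  shows "delta G n A *v w \<in> W"
  using assms(3)
proof (induction n arbitrary: w)
  case 0
  then show ?case using assms by (simp add: invariant_subspace_def)
next
  case (Suc n)
  then show ?case using assms(1)
    by (auto simp: commutator_vec invariant_subspace_def intro: vec.subspace_diff)
qed

lemma irreducible_set_delta_iff:
  "irreducible_set (insert G D) \<longleftrightarrow> irreducible_set {delta G n A | n A. A \<in> D}"
proof -
  let ?D = "{delta G n A | n A. A \<in> D}"
  have closed: "commutator G A \<in> ?D" if A: "A \<in> ?D" for A
  proof -
    obtain n B where "A = delta G n B" "B \<in> D" using A by blast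
    then have "commutator G A = delta G (Suc n) B" by simp
    with \<open>B \<in> D\<close> show ?thesis by blast
  qed
  have "irreducible_set (insert G ?D)" if "irreducible_set ?D"
    using that unfolding irreducible_set_def invariant_subspace_def by blast
  then have "irreducible_set (insert G ?D) \<longleftrightarrow> irreducible_set ?D"
    using irreducible_set_commutator_closed[OF _ closed] by blast
  moreover have "invariant_subspace (insert G D) W \<longleftrightarrow> invariant_subspace (insert G ?D) W" for W
  proof
    assume "invariant_subspace (insert G D) W"
    with invariant_subspace_delta[OF this] show "invariant_subspace (insert G ?D) W"
      by (auto simp: invariant_subspace_def)
  next
    have "D \<subseteq> ?D" by (auto intro: delta.simps(1)[symmetric])
    then show "invariant_subspace (insert G D) W" if "invariant_subspace (insert G ?D) W"
      using that unfolding invariant_subspace_def by blast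
  qed
  then have "irreducible_set (insert G D) \<longleftrightarrow> irreducible_set (insert G ?D)"
    by (simp add: irreducible_set_def)
  ultimately show ?thesis by simp
qed

lemma delta_word_Nil: "delta_word G L [] = mat 1"
  and delta_word_Cons: "delta_word G L ((n, l) # w) = delta G n (L l) ** delta_word G L w"
  by (simp_all add: delta_word_def)

lemma invariant_subspace_S_space:
  "invariant_subspace {delta (G_op m L H) n A | n A. A \<in> L ` {1..m}} (S_space m L H \<xi>)"
  unfolding invariant_subspace_def
proof (intro conjI ballI)
  show "vec.subspace (S_space m L H \<xi>)" by (simp add: S_space_def)
  let ?G = "G_op m L H"
  let ?B = "insert \<xi> {delta_word ?G L w *v \<xi> | w. w \<noteq> [] \<and> (\<forall>(n, l)\<in>set w. l \<in> {1..m})}"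
  fix A v assume "A \<in> {delta ?G n A | n A. A \<in> L ` {1..m}}" and v: "v \<in> S_space m L H \<xi>"
  then obtain n l where A: "A = delta ?G n (L l)" "l \<in> {1..m}" by auto
  have word: "delta_word ?G L w *v \<xi> \<in> vec.span ?B"
    if "w \<noteq> []" "\<forall>(n, l)\<in>set w. l \<in> {1..m}" for w
    using that by (intro vec.span_base) blast
  have "A *v b \<in> vec.span ?B" if "b \<in> ?B" for b
  proof -
    \<comment> \<open>Treating \<xi> as the empty word lets A act uniformly by prepending a
      letter.\<close>
    have "\<exists>w. b = delta_word ?G L w *v \<xi> \<and> (\<forall>(n, l)\<in>set w. l \<in> {1..m})"
    proof (cases "b = \<xi>")
      case True
      then show ?thesis by (intro exI[of _ "[]"]) (simp add: delta_word_Nil)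
    next
      case False
      with that show ?thesis by blast
    qed
    then obtain w where b: "b = delta_word ?G L w *v \<xi>" and w: "\<forall>(n, l)\<in>set w. l \<in> {1..m}"
      by blast
    then have "A *v b = delta_word ?G L ((n, l) # w) *v \<xi>"
      by (simp add: A delta_word_Cons matrix_vector_mul_assoc)
    then show ?thesis using word[of "(n, l) # w"] w A by simp
  qed
  moreover have "vec.subspace {v. A *v v \<in> vec.span ?B}"
    by (auto simp: vec.subspace_def vec.add vec.scale vec.span_zero vec.span_add vec.span_scale)
  ultimately have "vec.span ?B \<subseteq> {v. A *v v \<in> vec.span ?B}"
    by (intro vec.span_minimal) auto
  then show "A *v v \<in> S_space m L H \<xi>" using v by (auto simp: S_space_def)
qed

text \<open>Together with \<open>invariant_subspace_S_space\<close> this makes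
  \<open>S_space m L H \<xi>\<close> the smallest invariant subspace containing \<xi>.\<close>

lemma S_space_minimal:
  assumes W: "invariant_subspace {delta (G_op m L H) n A | n A. A \<in> L ` {1..m}} W" and \<xi>: "\<xi> \<in> W"
  shows "S_space m L H \<xi> \<subseteq> W"
proof -
  have "delta_word (G_op m L H) L w *v \<xi> \<in> W" if "\<forall>(n, l)\<in>set w. l \<in> {1..m}" for w
    using that
  proof (induction w)
    case Nil
    show ?case using \<xi> by (simp add: delta_word_Nil)
  next
    case (Cons nl w)
    obtain n l where "nl = (n, l)" by (cases nl)
    with Cons.prems have "l \<in> {1..m}" and IH: "delta_word (G_op m L H) L w *v \<xi> \<in> W"
      using Cons.IH by auto
    then have "delta (G_op m L H) n (L l) *v (delta_word (G_op m L H) L w *v \<xi>) \<in> W"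
      using W unfolding invariant_subspace_def by blast
    then show ?case
      by (simp add: \<open>nl = (n, l)\<close> delta_word_Cons matrix_vector_mul_assoc)
  qed
  then show ?thesis
    unfolding S_space_def using \<xi> W by (intro vec.span_minimal) (auto simp: invariant_subspace_def)
qed

text \<open>A set of matrices is irreducible iff every nonzero vector is cyclic for it.\<close>

lemma S_space_UNIV_iff:
  fixes L :: "nat \<Rightarrow> complex ^ 'n ^ 'n"
  shows "(\<forall>\<xi>. \<xi> \<noteq> 0 \<longrightarrow> S_space m L H \<xi> = UNIV) \<longleftrightarrow>
    irreducible_set {delta (G_op m L H) n A | n A. A \<in> L ` {1..m}}"
    (is "?S \<longleftrightarrow> irreducible_set ?D")
proof
  assume S: ?S
  show "irreducible_set ?D"
    unfolding irreducible_set_def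
  proof (intro allI impI)
    fix W assume W: "invariant_subspace ?D W"
    then have "0 \<in> W" by (simp add: invariant_subspace_def vec.subspace_0)
    then show "W = {0} \<or> W = UNIV"
      using S S_space_minimal[OF W] by blast
  qed
next
  assume irr: "irreducible_set ?D"
  show ?S
  proof (intro allI impI)
    fix \<xi> :: "complex ^ 'n" assume "\<xi> \<noteq> 0"
    moreover have "\<xi> \<in> S_space m L H \<xi>"
      unfolding S_space_def by (intro vec.span_base) simp
    moreover have "S_space m L H \<xi> = {0} \<or> S_space m L H \<xi> = UNIV"
      using irr invariant_subspace_S_space unfolding irreducible_set_def by blast
    ultimately show "S_space m L H \<xi> = UNIV" by auto
  qed
qed

theorem theorem6:
  fixes L :: "nat \<Rightarrow> complex ^ 'n ^ 'n" and H :: "complex ^ 'n ^ 'n" and m :: nat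
  assumes "adj H = H"
  shows "irreducible_qms (qms m L H) \<longleftrightarrow> (\<forall>\<xi>. \<xi> \<noteq> 0 \<longrightarrow> S_space m L H \<xi> = UNIV)"
  unfolding irreducible_qms_iff[OF assms] S_space_UNIV_iff by (rule irreducible_set_delta_iff)

end
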